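(* For $\theta \in [1,\infty)$ let $$f(x;\theta) = \begin{cases} a_\theta\, x^{-\theta} (\log x)^{-3} & \text{if } x \ge e,\\ 0 & \text{otherwise,}\end{cases}$$ where $a_\theta > 0$ is the constant chosen so that $f(\cdot\,;\theta)$ is a probability density function on $\mathbb{R}$. Then the information is infinite when $\theta = 1$, that is, $$\mathbb{E}\left[\left(\frac{\partial \log f(x;\theta)}{\partial \theta}\right)^2\right]\Bigg|_{\theta=1} = \int_e^\infty \left(\frac{\partial \log f(x;\theta)}{\partial\theta}\Big|_{\theta=1}\right)^2 f(x;1)\, dx = +\infty .$$ Equivalently, when $\theta = 1$, for any unbiased estimator $\widehat{\Theta}$ of $\theta$ based on $n \geq 1$ independent observations with density $f(x;\theta)$, the lower bound that the Cramér-Rao inequality provides for $\mathrm{Var}(\widehat{\Theta})$ is $0$, i.e. it yields only the trivial bound $\mathrm{Var}(\widehat{\Theta}) \ge 0$.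
   Context: Here $\log$ is the natural logarithm and $e$ is its base. The expectation $\mathbb{E}$ is taken with respect to the density $f(x;\theta)$. The parameter $\theta$ ranges over $[1,\infty)$, so $\theta=1$ is an endpoint and the derivative $\partial/\partial\theta$ at $\theta=1$ is the one-sided (right) derivative. The Cramér-Rao inequality states that, under its usual regularity conditions (differentiation in $\theta$ under the integral sign for the expectation of $\widehat\Theta$, and finite variance of $\widehat\Theta$), an unbiased estimator $\widehat{\Theta}(X_1,\dots,X_n)$ of $\theta$, with $X_1,\dots,X_n$ independent with density $f(x;\theta)$, satisfies $\mathrm{Var}(\widehat{\Theta}) \ge 1\big/\big(n\,\mathbb{E}[(\partial \log f(x;\theta)/\partial\theta)^2]\big)$. The expectation $\mathbb{E}[(\partial \log f(x;\theta)/\partial\theta)^2]$ is called the information. When the information is $+\infty$ the right-hand side is interpreted as $0$. *)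

theory Defs
  imports "HOL-Probability.Probability"
begin

definition is_pdf :: "(real \<Rightarrow> real) \<Rightarrow> bool" where
  "is_pdf g \<longleftrightarrow> g \<in> borel_measurable lborel \<and> (\<forall>x. 0 \<le> g x)
     \<and> (\<integral>\<^sup>+ x. ennreal (g x) \<partial>lborel) = 1"

definition pdf_shape :: "real \<Rightarrow> real \<Rightarrow> real \<Rightarrow> real" where
  "pdf_shape a \<theta> x =
     (if exp 1 \<le> x then a * x powr (- \<theta>) * (ln x) powi (-3) else 0)"

text \<open>The description below denotes only if such a constant exists and is unique;
  the theorem asserts this for all \<open>\<theta> \<ge> 1\<close>.\<close>

definition norm_const :: "real \<Rightarrow> real" where
  "norm_const \<theta> = (THE a. 0 < a \<and> is_pdf (pdf_shape a \<theta>))"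

definition log_pdf_family :: "real \<Rightarrow> real \<Rightarrow> real" where
  "log_pdf_family \<theta> = pdf_shape (norm_const \<theta>) \<theta>"

text \<open>In the following notions \<open>f \<theta>\<close> is the density for parameter \<open>\<theta>\<close> and \<open>\<Theta>\<close> is the parameter
  set. Derivatives in \<open>\<theta>\<close> are taken within \<open>\<Theta>\<close>, so they are one-sided at an endpoint.\<close>

definition obs_law :: "(real \<Rightarrow> real \<Rightarrow> real) \<Rightarrow> real \<Rightarrow> real measure" where
  "obs_law f \<theta> = density lborel (\<lambda>x. ennreal (f \<theta> x))"

definition score :: "real set \<Rightarrow> (real \<Rightarrow> real \<Rightarrow> real) \<Rightarrow> real \<Rightarrow> real \<Rightarrow> real" where
  "score \<Theta> f \<theta> x = vector_derivative (\<lambda>t. ln (f t x)) (at \<theta> within \<Theta>)"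

definition fisher_information :: "real set \<Rightarrow> (real \<Rightarrow> real \<Rightarrow> real) \<Rightarrow> real \<Rightarrow> ennreal" where
  "fisher_information \<Theta> f \<theta> = (\<integral>\<^sup>+ x. ennreal ((score \<Theta> f \<theta> x)\<^sup>2) \<partial>obs_law f \<theta>)"

text \<open>A sample of \<open>n\<close> independent observations is a point of \<open>{..<n} \<rightarrow>\<^sub>E UNIV\<close>
  under the product law.\<close>

definition sample_law :: "(real \<Rightarrow> real \<Rightarrow> real) \<Rightarrow> nat \<Rightarrow> real \<Rightarrow> (nat \<Rightarrow> real) measure" where
  "sample_law f n \<theta> = PiM {..<n} (\<lambda>_. obs_law f \<theta>)"

definition unbiased_estimator ::
  "real set \<Rightarrow> (real \<Rightarrow> real \<Rightarrow> real) \<Rightarrow> nat \<Rightarrow> ((nat \<Rightarrow> real) \<Rightarrow> real) \<Rightarrow> bool" where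
  "unbiased_estimator \<Theta> f n T \<longleftrightarrow>
     T \<in> borel_measurable (PiM {..<n} (\<lambda>_. borel)) \<and>
     (\<forall>\<theta>\<in>\<Theta>. integrable (sample_law f n \<theta>) T \<and> integral\<^sup>L (sample_law f n \<theta>) T = \<theta>)"

text \<open>The variance is \<open>ennreal\<close>-valued so that an estimator of infinite variance does not get the
  default value 0 of the Bochner integral.\<close>

definition estimator_variance ::
  "(real \<Rightarrow> real \<Rightarrow> real) \<Rightarrow> nat \<Rightarrow> ((nat \<Rightarrow> real) \<Rightarrow> real) \<Rightarrow> real \<Rightarrow> ennreal" where
  "estimator_variance f n T \<theta> =
     (\<integral>\<^sup>+ w. ennreal ((T w - integral\<^sup>L (sample_law f n \<theta>) T)\<^sup>2) \<partial>sample_law f n \<theta>)"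

text \<open>Division in \<open>ennreal\<close> satisfies \<open>1 / \<infinity> = 0\<close>.\<close>

definition cramer_rao_bound ::
  "real set \<Rightarrow> (real \<Rightarrow> real \<Rightarrow> real) \<Rightarrow> nat \<Rightarrow> real \<Rightarrow> ennreal" where
  "cramer_rao_bound \<Theta> f n \<theta> = 1 / (of_nat n * fisher_information \<Theta> f \<theta>)"

definition cramer_rao_inequality ::
  "real set \<Rightarrow> (real \<Rightarrow> real \<Rightarrow> real) \<Rightarrow> nat \<Rightarrow> ((nat \<Rightarrow> real) \<Rightarrow> real) \<Rightarrow> real \<Rightarrow> bool" where
  "cramer_rao_inequality \<Theta> f n T \<theta> \<longleftrightarrow>
     estimator_variance f n T \<theta> \<ge> cramer_rao_bound \<Theta> f n \<theta>"

end

theory Submission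
  imports Defs
begin

text \<open>
  Put \<open>K(\<theta>) = \<integral> x\<^sup>-\<^sup>\<theta> (log x)\<^sup>-\<^sup>3 dx\<close> over \<open>[e, \<infinity>)\<close>, so that the normalising constant is \<open>1 / K(\<theta>)\<close>
  and \<open>log f(x; \<theta>) = - log K(\<theta>) - \<theta> log x - 3 log log x\<close>. Here \<open>K(1) = 1/2\<close>, and dominated
  convergence with majorant \<open>1 / (x (log x)\<^sup>2)\<close> gives the right derivative \<open>K'(1) = -1\<close>. Hence
  the score at \<open>\<theta> = 1\<close> is \<open>2 - log x\<close>, and its square times the density behaves like
  \<open>2 / (x log x)\<close>, whose antiderivative \<open>2 log log x\<close> is unbounded.
\<close>

section \<open>Elementary properties of the unnormalised density\<close>

lemma ln_ge_one: "exp 1 \<le> x \<Longrightarrow> 1 \<le> ln (x::real)"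
  by (metis exp_gt_zero ln_exp ln_mono order_less_le_trans)

lemma pos_if_ge_exp: "exp b \<le> x \<Longrightarrow> 0 < (x::real)"
  by (metis exp_gt_zero order_less_le_trans)

lemma x_ln_cubed_nonneg: "exp 1 \<le> x \<Longrightarrow> 0 \<le> x * ln (x::real) ^ 3"
  using pos_if_ge_exp[of 1 x] ln_ge_one[of x]
  by (intro mult_nonneg_nonneg zero_le_power) (simp_all del: ln_ge_zero_iff)

lemma measurable_pdf_shape [measurable]: "pdf_shape a \<theta> \<in> borel_measurable borel"
  unfolding pdf_shape_def power_int_def by measurable

lemma pdf_shape_eq_mult: "pdf_shape a \<theta> x = a * pdf_shape 1 \<theta> x"
  by (simp add: pdf_shape_def)

lemma pdf_shape_nonneg: "0 \<le> a \<Longrightarrow> 0 \<le> pdf_shape a \<theta> x"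
  using ln_ge_one[of x] by (auto simp: pdf_shape_def intro!: mult_nonneg_nonneg zero_le_power_int)

lemma pdf_shape_one_one:
  "pdf_shape a 1 x = a / (x * ln x ^ 3) * indicator {exp 1..} x"
  using pos_if_ge_exp[of 1 x]
  by (auto simp: pdf_shape_def powr_minus power_int_minus divide_simps powr_one)

section \<open>Improper integrals at the endpoint\<close>

lemma tendsto_inverse_ln_power:
  "0 < n \<Longrightarrow> ((\<lambda>x::real. - c / ln x ^ n) \<longlongrightarrow> 0) at_top"
  by (intro tendsto_divide_0[OF tendsto_const] filterlim_at_top_imp_at_infinity
      filterlim_pow_at_top ln_at_top)

lemma nn_integral_inverse_ln_cubed:
  "(\<integral>\<^sup>+x. ennreal (1 / (x * ln x ^ 3)) * indicator {exp 1..} x \<partial>lborel) = ennreal (1/2)"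
proof -
  have "(\<integral>\<^sup>+x. ennreal (1 / (x * ln x ^ 3)) * indicator {exp 1..} x \<partial>lborel)
      = ennreal (0 - (- (1/2) / ln (exp 1) ^ 2))"
  proof (rule nn_integral_FTC_atLeast)
    fix x :: real assume x: "exp 1 \<le> x"
    note p = pos_if_ge_exp[OF x] and l = ln_ge_one[OF x]
    show "((\<lambda>x. - (1/2) / ln x ^ 2) has_real_derivative 1 / (x * ln x ^ 3)) (at x)"
      using p l by (auto intro!: derivative_eq_intros simp: field_simps power2_eq_square power3_eq_cube)
    show "0 \<le> 1 / (x * ln x ^ 3)" using x_ln_cubed_nonneg[OF x] by simp
  next
    show "((\<lambda>x::real. - (1/2) / ln x ^ 2) \<longlongrightarrow> 0) at_top"
      by (rule tendsto_inverse_ln_power) simp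
  qed measurable
  then show ?thesis by simp
qed

text \<open>The integrand serves twice below: it dominates the difference quotients of the shape in
  the parameter at 1, and its negative is their limit.\<close>

lemma nn_integral_inverse_ln_squared:
  "(\<integral>\<^sup>+x. ennreal (1 / (x * ln x ^ 2)) * indicator {exp 1..} x \<partial>lborel) = ennreal 1"
proof -
  have "(\<integral>\<^sup>+x. ennreal (1 / (x * ln x ^ 2)) * indicator {exp 1..} x \<partial>lborel)
      = ennreal (0 - (- 1 / ln (exp 1) ^ 1))"
  proof (rule nn_integral_FTC_atLeast)
    fix x :: real assume x: "exp 1 \<le> x"
    note p = pos_if_ge_exp[OF x] and l = ln_ge_one[OF x]
    show "((\<lambda>x. - 1 / ln x ^ 1) has_real_derivative 1 / (x * ln x ^ 2)) (at x)"
      using p l by (auto intro!: derivative_eq_intros simp: field_simps power2_eq_square)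
    show "0 \<le> 1 / (x * ln x ^ 2)" using p l by simp
  next
    show "((\<lambda>x::real. - 1 / ln x ^ 1) \<longlongrightarrow> 0) at_top"
      by (rule tendsto_inverse_ln_power) simp
  qed measurable
  then show ?thesis by simp
qed

lemma has_bochner_integral_inverse_ln_squared:
  "has_bochner_integral lborel (\<lambda>x. 1 / (x * ln x ^ 2) * indicator {exp 1..} x) (1::real)"
proof (rule has_bochner_integral_nn_integral)
  show "AE x in lborel. 0 \<le> 1 / (x * ln x ^ 2) * indicator {exp 1..} (x::real)"
    using pos_if_ge_exp[of 1] by (auto simp: indicator_def less_imp_le)
  show "(\<integral>\<^sup>+x. ennreal (1 / (x * ln x ^ 2) * indicator {exp 1..} x) \<partial>lborel) = ennreal 1"
    unfolding nn_integral_inverse_ln_squared[symmetric]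
    by (intro nn_integral_cong) (simp add: indicator_def)
qed auto

lemma has_bochner_integral_pdf_shape_one:
  "has_bochner_integral lborel (pdf_shape 1 1) (1/2)"
proof (rule has_bochner_integral_nn_integral)
  show "(\<integral>\<^sup>+x. ennreal (pdf_shape 1 1 x) \<partial>lborel) = ennreal (1/2)"
    unfolding nn_integral_inverse_ln_cubed[symmetric]
    by (intro nn_integral_cong) (simp add: indicator_def pdf_shape_one_one)
qed (auto simp: pdf_shape_nonneg)

section \<open>The normalising constant\<close>

lemma pdf_shape_antimono:
  assumes "0 \<le> a" "s \<le> t"
  shows "pdf_shape a t x \<le> pdf_shape a s x"
proof (cases "exp 1 \<le> x")
  case True
  have "x powr - t \<le> x powr - s"
    using True assms(2) order_trans[of 1 "exp 1" x] by (intro powr_mono) auto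
  then show ?thesis
    using True assms(1) ln_ge_one[OF True]
    by (auto simp: pdf_shape_def intro!: mult_right_mono mult_left_mono)
qed (simp add: pdf_shape_def)

text \<open>On the support \<open>x\<close> exceeds 1, so powers with larger \<open>\<theta>\<close>
  are smaller and the shape at \<open>\<theta> = 1\<close> dominates all the others.\<close>

lemma integrable_pdf_shape:
  assumes "1 \<le> \<theta>"
  shows "integrable lborel (pdf_shape 1 \<theta>)"
proof (rule Bochner_Integration.integrable_bound)
  show "integrable lborel (pdf_shape 1 1)"
    using has_bochner_integral_pdf_shape_one by (rule integrable.intros)
  show "AE x in lborel. norm (pdf_shape 1 \<theta> x) \<le> norm (pdf_shape 1 1 x)"
    using pdf_shape_antimono[OF _ assms, of 1] by (simp add: pdf_shape_nonneg)
qed simp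

text \<open>This is the function K of the outline. The Bochner integral defaults to 0 where the
  shape is not integrable, so the facts about it are confined to
  \<open>\<theta> \<ge> 1\<close>.\<close>

definition shape_mass :: "real \<Rightarrow> real" where
  "shape_mass \<theta> = (\<integral>x. pdf_shape 1 \<theta> x \<partial>lborel)"

lemma shape_mass_one: "shape_mass 1 = 1/2"
  unfolding shape_mass_def
  using has_bochner_integral_pdf_shape_one by (rule has_bochner_integral_integral_eq)

text \<open>A nonnegative function with integral 0 vanishes almost everywhere, but the shape is
  nonzero on an interval of length 1.\<close>

lemma shape_mass_pos:
  assumes "1 \<le> \<theta>"
  shows "0 < shape_mass \<theta>"
proof -
  have "emeasure lborel {exp 1..exp 1 + 1 :: real} \<le> emeasure lborel {x \<in> space lborel. pdf_shape 1 \<theta> x \<noteq> 0}"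
    using ln_ge_one pos_if_ge_exp by (intro emeasure_mono) (fastforce simp: pdf_shape_def)+
  then have "\<not> (AE x in lborel. pdf_shape 1 \<theta> x = 0)"
    by (subst AE_iff_measurable[OF _ refl]) (auto simp: not_le)
  then have "shape_mass \<theta> \<noteq> 0"
    unfolding shape_mass_def
    using integral_nonneg_eq_0_iff_AE[OF integrable_pdf_shape[OF assms]] pdf_shape_nonneg[of 1] by simp
  moreover have "0 \<le> shape_mass \<theta>"
    unfolding shape_mass_def by (intro integral_nonneg_AE) (simp add: pdf_shape_nonneg)
  ultimately show ?thesis by simp
qed

lemma is_pdf_pdf_shape_iff:
  assumes "1 \<le> \<theta>" "0 < a"
  shows "is_pdf (pdf_shape a \<theta>) \<longleftrightarrow> a = 1 / shape_mass \<theta>"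
proof -
  have "(\<integral>\<^sup>+x. ennreal (pdf_shape a \<theta> x) \<partial>lborel) = ennreal (\<integral>x. pdf_shape a \<theta> x \<partial>lborel)"
    using integrable_pdf_shape[OF assms(1)] assms(2)
    by (intro nn_integral_eq_integral)
       (simp_all add: pdf_shape_nonneg pdf_shape_eq_mult[of a, abs_def])
  also have "\<dots> = ennreal (a * shape_mass \<theta>)"
    by (simp add: pdf_shape_eq_mult[of a, abs_def] shape_mass_def)
  finally show ?thesis
    using assms(2) shape_mass_pos[OF assms(1)]
    by (auto simp: is_pdf_def pdf_shape_nonneg field_simps simp del: ennreal_1 simp flip: ennreal_1)
qed

lemma ex1_norm_const:
  assumes "1 \<le> \<theta>"
  shows "\<exists>!a. 0 < a \<and> is_pdf (pdf_shape a \<theta>)"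
  using is_pdf_pdf_shape_iff[OF assms] shape_mass_pos[OF assms]
  by (intro ex1I[of _ "1 / shape_mass \<theta>"]) auto

lemma norm_const_eq:
  assumes "1 \<le> \<theta>"
  shows "norm_const \<theta> = 1 / shape_mass \<theta>"
  unfolding norm_const_def
  using is_pdf_pdf_shape_iff[OF assms] shape_mass_pos[OF assms]
  by (intro the_equality) auto

section \<open>Differentiating the mass at the endpoint\<close>

lemma pdf_shape_powr_factor:
  "pdf_shape 1 t x = exp (- (t - 1) * ln x) / (x * ln x ^ 3) * indicator {exp 1..} x"
  using pos_if_ge_exp[of 1 x]
  by (auto simp: pdf_shape_def powr_def power_int_minus field_simps exp_diff exp_minus)

lemma shape_mass_has_derivative:
  "(shape_mass has_real_derivative -1) (at 1 within {1..})"
proof -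
  let ?w = "\<lambda>x::real. 1 / (x * ln x ^ 2) * indicator {exp 1..} x"
  let ?q = "\<lambda>t x. (pdf_shape 1 t x - pdf_shape 1 1 x) / (t - 1)"
  have "((\<lambda>t. (shape_mass t - shape_mass 1) / (t - 1)) \<longlongrightarrow> -1) (at 1 within {1..})"
    \<comment> \<open>Dominated convergence is applied along an arbitrary sequence that tends to 1
      from the right.\<close>
    unfolding tendsto_at_iff_sequentially comp_def
  proof (intro allI impI)
    fix X :: "nat \<Rightarrow> real"
    assume X: "\<forall>i. X i \<in> {1..} - {1}" and lim: "X \<longlonglongrightarrow> 1"
    have X1: "1 < X i" for i using X by (auto simp: less_le)
    have "(\<lambda>i. \<integral>x. ?q (X i) x \<partial>lborel) \<longlonglongrightarrow> (\<integral>x. - ?w x \<partial>lborel)"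
    proof (rule integral_dominated_convergence)
      show "integrable lborel ?w"
        using has_bochner_integral_inverse_ln_squared by (rule integrable.intros)
      show "AE x in lborel. (\<lambda>i. ?q (X i) x) \<longlonglongrightarrow> - ?w x"
      proof (rule AE_I2)
        fix x :: real
        \<comment> \<open>For fixed \<open>x\<close> the shape is smooth in all real
          \<open>t\<close>, so the pointwise derivative is two-sided; only the integral needs
          \<open>t \<ge> 1\<close>.\<close>
        have "((\<lambda>t. pdf_shape 1 t x) has_real_derivative - ?w x) (at 1)"
          using pos_if_ge_exp[of 1 x] ln_ge_one[of x] unfolding pdf_shape_powr_factor
          by (auto intro!: derivative_eq_intros simp: indicator_def field_simps power2_eq_square power3_eq_cube)
        then have "((\<lambda>t. ?q t x) \<longlongrightarrow> - ?w x) (at 1)"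
          by (simp add: has_field_derivative_iff)
        moreover have "filterlim X (at 1) sequentially"
          using lim X by (auto simp: filterlim_at)
        ultimately show "(\<lambda>i. ?q (X i) x) \<longlonglongrightarrow> - ?w x"
          by (rule filterlim_compose)
      qed
      show "AE x in lborel. norm (?q (X i) x) \<le> ?w x" for i
      proof (rule AE_I2)
        fix x :: real
        show "norm (?q (X i) x) \<le> ?w x"
        proof (cases "exp 1 \<le> x")
          case True
          note p = pos_if_ge_exp[OF True] and l = ln_ge_one[OF True]
          \<comment> \<open>For \<open>u \<le> 0\<close> the value \<open>exp u\<close> lies between
            \<open>1 + u\<close> and 1. This bounds the quotient uniformly in \<open>i\<close>, at
            the cost of one factor \<open>ln x\<close>.\<close>
          have "1 - (X i - 1) * ln x \<le> exp (- (X i - 1) * ln x)"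
            using exp_ge_add_one_self[of "- (X i - 1) * ln x"] by linarith
          moreover have "exp (- (X i - 1) * ln x) \<le> 1"
            using X1[of i] l by (simp add: mult_nonpos_nonneg)
          ultimately have "\<bar>exp (- (X i - 1) * ln x) - 1\<bar> \<le> (X i - 1) * ln x" by linarith
          then have "\<bar>exp (- (X i - 1) * ln x) - 1\<bar> / (X i - 1) / (x * ln x ^ 3)
              \<le> ln x / (x * ln x ^ 3)"
            using X1[of i] x_ln_cubed_nonneg[OF True]
            by (intro divide_right_mono) (simp_all add: field_simps)
          moreover have "norm (?q (X i) x) = \<bar>exp (- (X i - 1) * ln x) - 1\<bar> / (X i - 1) / (x * ln x ^ 3)"
            using True X1[of i] p abs_of_nonneg[of "ln x"] l unfolding pdf_shape_powr_factor
            by (simp add: abs_mult abs_divide power_abs del: ln_ge_zero_iff flip: diff_divide_distrib)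
          ultimately show ?thesis
            using True p l by (auto simp: power2_eq_square power3_eq_cube split: if_splits)
        qed (simp add: pdf_shape_def)
      qed
    qed simp_all
    moreover have "(\<integral>x. ?q (X i) x \<partial>lborel) = (shape_mass (X i) - shape_mass 1) / (X i - 1)" for i
      using integrable_pdf_shape[of "X i"] integrable_pdf_shape[of 1] X1[of i]
      by (simp add: shape_mass_def less_imp_le)
    moreover have "(\<integral>x. - ?w x \<partial>lborel) = -1"
      using has_bochner_integral_integral_eq[OF has_bochner_integral_inverse_ln_squared] by simp
    ultimately show "(\<lambda>i. (shape_mass (X i) - shape_mass 1) / (X i - 1)) \<longlonglongrightarrow> -1"
      by (simp only:)
  qed
  then show ?thesis by (simp add: has_field_derivative_iff)
qed

section \<open>The score and the information integral\<close>

lemma ln_log_pdf_family_has_derivative: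
  assumes x: "exp 1 \<le> x"
  shows "((\<lambda>\<theta>. ln (log_pdf_family \<theta> x)) has_real_derivative 2 - ln x) (at 1 within {1..})"
proof (rule has_field_derivative_transform_within)
  note p = pos_if_ge_exp[OF x] and l = ln_ge_one[OF x]
  \<comment> \<open>The constant 2 in the derivative is -K'(1)/K(1), with K'(1) = -1 and K(1) =
    1/2.\<close>
  let ?g = "\<lambda>\<theta>. - ln (shape_mass \<theta>) - \<theta> * ln x + ln (ln x powi (-3))"
  show "(?g has_real_derivative 2 - ln x) (at 1 within {1..})"
    by (auto intro!: derivative_eq_intros shape_mass_has_derivative simp: shape_mass_one)
  show "?g \<theta> = ln (log_pdf_family \<theta> x)" if "\<theta> \<in> {1..}" for \<theta>
    using that x p l shape_mass_pos[of \<theta>]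
    by (auto simp: log_pdf_family_def norm_const_eq pdf_shape_def ln_mult ln_div ln_powr)
  show "0 < (1::real)" "(1::real) \<in> {1..}" by simp_all
qed

lemma score_log_pdf_family_one:
  "score {1..} log_pdf_family 1 x = (if exp 1 \<le> x then 2 - ln x else 0)"
proof -
  have nt: "at (1::real) within {1..} \<noteq> bot"
    by (simp add: at_within_Ici_at_right)
  \<comment> \<open>Off the support the function of \<open>t\<close> is constantly
    \<open>ln 0\<close>, hence has derivative 0.\<close>
  have "((\<lambda>t. ln (log_pdf_family t x)) has_vector_derivative (if exp 1 \<le> x then 2 - ln x else 0))
      (at 1 within {1..})"
    using ln_log_pdf_family_has_derivative[of x]
    by (auto simp: has_real_derivative_iff_has_vector_derivative log_pdf_family_def pdf_shape_def)
  then show ?thesis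
    unfolding score_def by (rule vector_derivative_within[OF nt])
qed

text \<open>The density of \<open>obs_law\<close> moves into the integrand; restricting to the
  support loses nothing because the score is 0 outside it.\<close>

lemma fisher_information_eq_set_integral:
  "fisher_information {1..} log_pdf_family 1
     = (\<integral>\<^sup>+ x\<in>{exp 1..}.
          ennreal ((score {1..} log_pdf_family 1 x)\<^sup>2 * log_pdf_family 1 x) \<partial>lborel)"
proof -
  have [measurable]: "score {1..} log_pdf_family 1 \<in> borel_measurable borel"
    unfolding score_log_pdf_family_one[abs_def] by measurable
  have [measurable]: "log_pdf_family 1 \<in> borel_measurable borel"
    by (simp add: log_pdf_family_def)
  have nn: "0 \<le> log_pdf_family 1 x" for x
    by (simp add: log_pdf_family_def pdf_shape_nonneg norm_const_eq shape_mass_one)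
  show ?thesis
    unfolding fisher_information_def obs_law_def
    by (subst nn_integral_density)
       (auto intro!: nn_integral_cong
          simp: nn mult.commute indicator_def score_log_pdf_family_one simp flip: ennreal_mult)
qed

section \<open>Divergence of the information\<close>

lemma nn_integral_inverse_x_ln_infinite:
  assumes "1 < b"
  shows "(\<integral>\<^sup>+x. ennreal (1 / (x * ln x)) * indicator {b..} x \<partial>lborel) = \<infinity>"
proof -
  let ?I = "\<integral>\<^sup>+x. ennreal (1 / (x * ln x)) * indicator {b..} x \<partial>lborel"
  have le: "ennreal (ln (ln c) - ln (ln b)) \<le> ?I" if "b \<le> c" for c
  proof -
    have "(\<integral>\<^sup>+x. ennreal (1 / (x * ln x)) * indicator {b..c} x \<partial>lborel) = ennreal (ln (ln c) - ln (ln b))"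
    proof (rule nn_integral_FTC_Icc)
      show "b \<le> c" by fact
      fix x :: real assume x: "x \<in> {b..c}"
      then show "((\<lambda>x. ln (ln x)) has_real_derivative 1 / (x * ln x)) (at x)"
        using assms
        by (auto intro!: derivative_eq_intros simp: field_simps)
      show "0 \<le> 1 / (x * ln x)" using x assms by simp
    qed measurable
    moreover have "(\<integral>\<^sup>+x. ennreal (1 / (x * ln x)) * indicator {b..c} x \<partial>lborel) \<le> ?I"
      by (intro nn_integral_mono) (auto simp: indicator_def)
    ultimately show ?thesis by simp
  qed
  show ?thesis
  proof (rule ccontr)
    assume "?I \<noteq> \<infinity>"
    then obtain r where r: "0 \<le> r" "?I = ennreal r" by (cases ?I) auto
    \<comment> \<open>Truncating at \<open>exp (exp y)\<close> makes the increment of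
      \<open>ln (ln x)\<close> equal to \<open>r + 1\<close>, more than the supposed total
      \<open>r\<close>.\<close>
    define y where "y = ln (ln b) + r + 1"
    have "b \<le> exp (exp y)"
    proof -
      have "ln (ln b) \<le> y" using r by (simp add: y_def)
      then show ?thesis using assms
        by (metis exp_gt_zero exp_le_cancel_iff exp_ln less_trans ln_gt_zero zero_less_one)
    qed
    from le[OF this] r show False by (simp add: y_def)
  qed
qed

lemma fisher_information_infinite: "fisher_information {1..} log_pdf_family 1 = \<infinity>"
proof -
  \<comment> \<open>Once \<open>ln x \<ge> 4\<close>, the score has absolute value at least
    \<open>ln x / 2\<close>. The factor 1/2 is the resulting 1/4 times the normalising constant
    2.\<close>
  have "ennreal (1/2) * ennreal (1 / (x * ln x)) * indicator {exp 4..} x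
      \<le> ennreal ((score {1..} log_pdf_family 1 x)\<^sup>2 * log_pdf_family 1 x) * indicator {exp 1..} x"
    for x :: real
  proof (cases "exp 4 \<le> x")
    case True
    have p: "0 < x" using True by (rule pos_if_ge_exp)
    have l: "4 \<le> ln x" using True p by (simp add: ln_ge_iff)
    have x: "exp 1 \<le> x" using True order_trans[of "exp 1" "exp (4::real)" x] by simp
    have "(1/2) * (1 / (x * ln x)) = ln x ^ 2 / 4 * (2 / (x * ln x ^ 3))"
      using p l by (simp add: field_simps power2_eq_square power3_eq_cube)
    also have "\<dots> \<le> (2 - ln x)\<^sup>2 * (2 / (x * ln x ^ 3))"
    proof (rule mult_right_mono)
      have "(ln x / 2)\<^sup>2 \<le> (ln x - 2)\<^sup>2" using l by (intro power_mono) auto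
      then show "ln x ^ 2 / 4 \<le> (2 - ln x)\<^sup>2" by (simp add: power_divide power2_commute)
    next
      show "0 \<le> 2 / (x * ln x ^ 3)" using x_ln_cubed_nonneg[OF x] by simp
    qed
    also have "\<dots> = (score {1..} log_pdf_family 1 x)\<^sup>2 * log_pdf_family 1 x"
      using x by (simp add: score_log_pdf_family_one log_pdf_family_def norm_const_eq
          shape_mass_one pdf_shape_one_one)
    finally have le: "1 / 2 * (1 / (x * ln x)) \<le> \<dots>" .
    have "ennreal (1/2) * ennreal (1 / (x * ln x)) = ennreal (1 / 2 * (1 / (x * ln x)))"
      using p l by (intro ennreal_mult[symmetric]) (simp_all add: zero_le_mult_iff del: ln_ge_zero_iff)
    also have "\<dots> \<le> ennreal ((score {1..} log_pdf_family 1 x)\<^sup>2 * log_pdf_family 1 x)"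
      by (rule ennreal_leI[OF le])
    finally show ?thesis using True x by simp
  qed simp
  then have "(\<integral>\<^sup>+x. ennreal (1/2) * ennreal (1 / (x * ln x)) * indicator {exp 4..} x \<partial>lborel)
      \<le> fisher_information {1..} log_pdf_family 1"
    unfolding fisher_information_eq_set_integral by (intro nn_integral_mono)
  moreover have "(\<integral>\<^sup>+x. ennreal (1/2) * ennreal (1 / (x * ln x)) * indicator {exp 4..} x \<partial>lborel) = \<infinity>"
    using nn_integral_inverse_x_ln_infinite[of "exp 4"]
    by (simp add: mult.assoc nn_integral_cmult ennreal_mult_top)
  ultimately show ?thesis by (simp add: top_unique)
qed

text \<open>The first two conjuncts certify that the description in \<open>norm_const\<close> and,
  on the support, the derivative in \<open>score\<close> really denote. In the last one,
  \<open>n \<ge> 1\<close> matters because 0 times infinity is 0 in \<open>ennreal\<close>.\<close>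

theorem mainTheorem1:
  shows "(\<forall>\<theta>::real. 1 \<le> \<theta> \<longrightarrow> (\<exists>!a. 0 < a \<and> is_pdf (pdf_shape a \<theta>)))
    \<and> (\<forall>x::real. exp 1 \<le> x \<longrightarrow>
          ((\<lambda>\<theta>. ln (log_pdf_family \<theta> x)) has_real_derivative score {1..} log_pdf_family 1 x)
            (at 1 within {1..}))
    \<and> fisher_information {1..} log_pdf_family 1
        = (\<integral>\<^sup>+ x\<in>{exp 1..}.
             ennreal ((score {1..} log_pdf_family 1 x)\<^sup>2 * log_pdf_family 1 x) \<partial>lborel)
    \<and> fisher_information {1..} log_pdf_family 1 = \<infinity>
    \<and> (\<forall>n::nat. 1 \<le> n \<longrightarrow>
          cramer_rao_bound {1..} log_pdf_family n 1 = 0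
          \<and> (\<forall>T. unbiased_estimator {1..} log_pdf_family n T \<longrightarrow>
               (cramer_rao_inequality {1..} log_pdf_family n T 1
                  \<longleftrightarrow> 0 \<le> estimator_variance log_pdf_family n T 1)))"
  using ex1_norm_const ln_log_pdf_family_has_derivative fisher_information_eq_set_integral
    fisher_information_infinite
  by (auto simp: score_log_pdf_family_one cramer_rao_bound_def cramer_rao_inequality_def
      ennreal_mult_top)

end
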